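(* Let $N>2$, let $\alpha_\mu<0$ for $0<\mu<N$ be fixed, put $|\alpha_\tau|:=\min_{0<\mu<N}|\alpha_\mu|$ and $\alpha_{(c)}:=\big(\sum_{\mu=1}^{N-1}|\alpha_\mu|^{-1}\big)^{-1}$. For $\alpha_0>0$ let $E(\alpha_0)$ denote the minimal energy of the spin polygon with couplings $\alpha_0,\alpha_1,\dots,\alpha_{N-1}$. Then on the interval $\alpha_{(c)}<\alpha_0<|\alpha_\tau|$ the function $E(\alpha_0)$ has exactly one extremum; it is a maximum and is attained at $\alpha_0=\alpha_{(em)}$, the unique solution in $[0,|\alpha_\tau|]$ of $$\frac{\pi}{2}=\sum_{\mu=1}^{N-1}\arcsin\frac{\alpha_{(em)}}{|\alpha_\mu|},$$ which satisfies $\alpha_{(em)}<|\alpha_\tau|$. Moreover, to second order for $\alpha_0$ near $\alpha_{(em)}$, $$E(\alpha_0)\simeq E_{\max}-e_2\,(\alpha_0-\alpha_{(em)})^2,$$ where $$E_{\max}=-\sum_{\mu=1}^{N-1}\sqrt{\alpha_\mu^2-\alpha_{(em)}^2},\qquad e_2=\frac12\sum_{\mu=1}^{N-1}\big(\alpha_\mu^2-\alpha_{(em)}^2\big)^{-1/2}>0.$$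
   Context: The spin polygon with couplings $\alpha_0,\dots,\alpha_{N-1}$ consists of unit vectors $\mathbf{s}_0,\dots,\mathbf{s}_{N-1}\in\mathbb{R}^3$ (indices modulo $N$) with energy $\sum_{\mu=0}^{N-1}\alpha_\mu\,\mathbf{s}_\mu\cdot\mathbf{s}_{\mu+1}$; $E(\alpha_0)$ is the global minimum of this energy over all configurations. Equivalently, $E(\alpha_0)$ is the global minimum over $(\psi_1,\dots,\psi_{N-1})\in\mathbb{R}^{N-1}$ of $\alpha_0\cos\big(\sum_{\mu=1}^{N-1}\psi_\mu\big)-\sum_{\mu=1}^{N-1}|\alpha_\mu|\cos\psi_\mu$. The symbol $\simeq$ means equality up to terms of order higher than two in $\alpha_0-\alpha_{(em)}$. *)

theory Defs
  imports "HOL-Analysis.Analysis" "HOL-Library.Landau_Symbols"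
begin

definition spin_configurations :: "nat \<Rightarrow> (nat \<Rightarrow> real ^ 3) set" where
  "spin_configurations N = {s. \<forall>\<mu><N. norm (s \<mu>) = 1}"

definition spin_polygon_energy :: "nat \<Rightarrow> (nat \<Rightarrow> real) \<Rightarrow> (nat \<Rightarrow> real ^ 3) \<Rightarrow> real" where
  "spin_polygon_energy N \<alpha> s = (\<Sum>\<mu><N. \<alpha> \<mu> * (s \<mu> \<bullet> s ((\<mu> + 1) mod N)))"

text \<open>The infimum below is a minimum; see \<open>minimal_energy_attained\<close>.\<close>

definition minimal_energy :: "nat \<Rightarrow> (nat \<Rightarrow> real) \<Rightarrow> real" where
  "minimal_energy N \<alpha> = (INF s\<in>spin_configurations N. spin_polygon_energy N \<alpha> s)"

lemma minimal_energy_attained: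
  assumes "N > 0"
  obtains s where "s \<in> spin_configurations N"
    and "spin_polygon_energy N \<alpha> s = minimal_energy N \<alpha>"
    and "\<And>t. t \<in> spin_configurations N \<Longrightarrow> minimal_energy N \<alpha> \<le> spin_polygon_energy N \<alpha> t"
proof -
  let ?e = "spin_polygon_energy N \<alpha>"
  let ?K = "PiE UNIV (\<lambda>_::nat. sphere (0 :: real ^ 3) 1)"
  have "compactin (product_topology (\<lambda>_::nat. euclidean :: (real ^ 3) topology) UNIV) ?K"
    by (simp add: compactin_PiE)
  then have "compact ?K"
    by (simp add: euclidean_product_topology)
  moreover have "?K \<noteq> {}"
    by (auto simp: PiE_eq_empty_iff)
  moreover have "continuous_on ?K ?e"
    unfolding spin_polygon_energy_def
    by (intro continuous_intros continuous_on_product_then_coordinatewise continuous_on_id)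
  ultimately obtain s where s: "s \<in> ?K" "\<And>t. t \<in> ?K \<Longrightarrow> ?e s \<le> ?e t"
    using continuous_attains_inf[of ?K ?e] by blast
  have sN: "s \<in> spin_configurations N"
    using s(1) by (auto simp: spin_configurations_def PiE_iff)
  have le: "?e s \<le> ?e t" if "t \<in> spin_configurations N" for t
  proof -
    have "(\<lambda>\<mu>. t (\<mu> mod N)) \<in> ?K"
      using that assms by (auto simp: spin_configurations_def PiE_iff)
    moreover have "?e (\<lambda>\<mu>. t (\<mu> mod N)) = ?e t"
      unfolding spin_polygon_energy_def by (intro sum.cong) auto
    ultimately show ?thesis
      using s(2) by metis
  qed
  have "minimal_energy N \<alpha> = ?e s"
    unfolding minimal_energy_def using sN le
    by (intro cInf_eq_minimum) auto
  with sN le show thesis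
    by (intro that[of s]) auto
qed

text \<open>Extrema are local and not required to be strict.\<close>

definition local_max_at :: "(real \<Rightarrow> real) \<Rightarrow> real \<Rightarrow> bool" where
  "local_max_at f x \<longleftrightarrow> (\<forall>\<^sub>F y in nhds x. f y \<le> f x)"

definition local_min_at :: "(real \<Rightarrow> real) \<Rightarrow> real \<Rightarrow> bool" where
  "local_min_at f x \<longleftrightarrow> (\<forall>\<^sub>F y in nhds x. f x \<le> f y)"

definition local_extremum_at :: "(real \<Rightarrow> real) \<Rightarrow> real \<Rightarrow> bool" where
  "local_extremum_at f x \<longleftrightarrow> local_max_at f x \<or> local_min_at f x"

end

theory Submission imports Defs begin

text \<open>The minimal energy is concave in \<open>\<alpha>\<^sub>0\<close>, being a minimum of affine functions, so its local extrema
  are its global maxima, and a strict local maximum is the only one. Near \<open>a\<close> the energy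
  is known exactly in parametrized form: with \<open>\<Psi> k = (\<Sum>\<mu>. arcsin (k / \<bar>\<alpha> \<mu>\<bar>))\<close>, one has
  \<open>E (k / sin (\<Psi> k)) = k * cot (\<Psi> k) - (\<Sum>\<mu>. sqrt ((\<alpha> \<mu>)\<^sup>2 - k\<^sup>2))\<close> as long as \<open>\<Psi> k < pi\<close>. The upper
  bound is a planar configuration; the lower bound adds up quadratic forms \<open>q \<psi> u v\<close>, one for
  each bond, that satisfy \<open>q (\<psi> + \<phi>) u w \<le> q \<psi> u v + q \<phi> v w\<close>. Since \<open>dE/d\<alpha>\<^sub>0 = cos (\<Psi> k)\<close>, the
  maximum is at \<open>\<Psi> a = pi / 2\<close>.\<close>

section \<open>Concave functions, second-order expansion and the arcsine chord\<close>

text \<open>At a local minimum, midpoint concavity for z and its mirror image 2 * x - z gives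
  \<open>f z\<close> at most \<open>f x\<close>, so f is constant near x and x is a local maximum
  too. From a local maximum, a short step towards y stays at or below \<open>f x\<close>, and
  concavity along the segment carries the bound to y.\<close>

lemma concave_local_extremum_imp_global_max:
  fixes f :: "real \<Rightarrow> real"
  assumes f: "concave_on UNIV f" and x: "local_extremum_at f x"
  shows "f y \<le> f x"
proof -
  have "local_max_at f x"
  proof (rule ccontr)
    assume "\<not> local_max_at f x"
    with x have min: "local_min_at f x" by (simp add: local_extremum_at_def)
    then obtain d where d: "d > 0" "\<And>z. \<bar>z - x\<bar> < d \<Longrightarrow> f x \<le> f z"
      by (auto simp: local_min_at_def eventually_nhds_metric dist_real_def)
    have "f z \<le> f x" if "\<bar>z - x\<bar> < d" for z
    proof -
      have "(1 - 1 / 2) * f z + 1 / 2 * f (2 * x - z) \<le> f ((1 - 1 / 2) *\<^sub>R z + (1 / 2) *\<^sub>R (2 * x - z))"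
        by (rule concave_onD[OF f]) auto
      moreover have "f x \<le> f (2 * x - z)" using that by (intro d) auto
      ultimately show ?thesis by (simp add: field_simps)
    qed
    then have "local_max_at f x"
      using d(1) by (auto simp: local_max_at_def eventually_nhds_metric dist_real_def)
    with \<open>\<not> local_max_at f x\<close> show False ..
  qed
  then obtain d where d: "d > 0" "\<And>z. \<bar>z - x\<bar> < d \<Longrightarrow> f z \<le> f x"
    by (auto simp: local_max_at_def eventually_nhds_metric dist_real_def)
  \<comment> \<open>The quotient makes the step t * |y - x| shorter than d; the + 1 covers y = x,
    and the cap at 1 keeps t a convex weight.\<close>
  define t where "t = min 1 (d / (2 * (\<bar>y - x\<bar> + 1)))"
  have "0 < d / (2 * (\<bar>y - x\<bar> + 1))" using d(1) by (intro divide_pos_pos mult_pos_pos add_nonneg_pos) auto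
  then have t: "0 < t" "t \<le> 1" by (auto simp: t_def)
  have "t * \<bar>y - x\<bar> \<le> d / (2 * (\<bar>y - x\<bar> + 1)) * \<bar>y - x\<bar>"
    by (intro mult_right_mono) (auto simp: t_def)
  also have "\<dots> < d" using d(1) by (simp add: field_simps add_pos_nonneg)
  finally have "\<bar>t * (y - x)\<bar> < d" using t by (simp add: abs_mult)
  moreover have eq: "(1 - t) *\<^sub>R x + t *\<^sub>R y = x + t * (y - x)" by (simp add: algebra_simps)
  ultimately have "f ((1 - t) *\<^sub>R x + t *\<^sub>R y) \<le> f x"
    unfolding eq by (intro d(2)) simp
  moreover have "(1 - t) * f x + t * f y \<le> f ((1 - t) *\<^sub>R x + t *\<^sub>R y)"
    using t by (intro concave_onD[OF f]) auto
  ultimately have "t * f y \<le> t * f x" by (simp add: algebra_simps)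
  with t show ?thesis by simp
qed

text \<open>If y differed from a, concavity would keep f at or above \<open>f a\<close> on the whole
  segment from a to y, which contradicts strictness close to a.\<close>

lemma concave_max_unique:
  fixes f :: "real \<Rightarrow> real"
  assumes f: "concave_on UNIV f" and strict: "\<forall>\<^sub>F z in at a. f z < f a" and y: "f a \<le> f y"
  shows "y = a"
proof (rule ccontr)
  assume "y \<noteq> a"
  obtain d where d: "d > 0" "\<And>z. z \<noteq> a \<Longrightarrow> \<bar>z - a\<bar> < d \<Longrightarrow> f z < f a"
    using strict by (auto simp: eventually_at dist_real_def)
  define t where "t = min 1 (d / (2 * (\<bar>y - a\<bar> + 1)))"
  have "0 < d / (2 * (\<bar>y - a\<bar> + 1))" using d(1) by (intro divide_pos_pos mult_pos_pos add_nonneg_pos) auto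
  then have t: "0 < t" "t \<le> 1" by (auto simp: t_def)
  have "t * \<bar>y - a\<bar> \<le> d / (2 * (\<bar>y - a\<bar> + 1)) * \<bar>y - a\<bar>"
    by (intro mult_right_mono) (auto simp: t_def)
  also have "\<dots> < d" using d(1) by (simp add: field_simps add_pos_nonneg)
  finally have lt: "\<bar>t * (y - a)\<bar> < d" using t by (simp add: abs_mult)
  have eq: "(1 - t) *\<^sub>R a + t *\<^sub>R y = a + t * (y - a)" by (simp add: algebra_simps)
  have "f (a + t * (y - a)) < f a"
    using t lt \<open>y \<noteq> a\<close> by (intro d) auto
  moreover have "(1 - t) * f a + t * f y \<le> f ((1 - t) *\<^sub>R a + t *\<^sub>R y)"
    using t by (intro concave_onD[OF f]) auto
  moreover have "t * f a \<le> t * f y" using y t by simp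
  ultimately show False unfolding eq by (simp add: algebra_simps)
qed

text \<open>Comparing derivatives in the parameter \<open>k\<close> avoids second derivatives of \<open>X\<close> and any inverse
  function; the intermediate value theorem shows that \<open>X\<close> reaches every point near \<open>a\<close>.\<close>

lemma second_order_expansion_reparam:
  fixes f F X X' p :: "real \<Rightarrow> real"
  assumes X: "\<forall>\<^sub>F k in nhds a. (X has_real_derivative X' k) (at k)"
    and F: "\<forall>\<^sub>F k in nhds a. (F has_real_derivative p k * X' k) (at k)"
    and f: "\<forall>\<^sub>F k in nhds a. f (X k) = F k"
    and Xa: "X a = a" "X' a = 1" "isCont X' a"
    and p: "(p has_real_derivative c) (at a)" "p a = 0"
  shows "(\<lambda>x. f x - (f a + c / 2 * (x - a)\<^sup>2)) \<in> o[at a](\<lambda>x. (x - a)\<^sup>2)"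
proof (rule landau_o.smallI)
  fix \<epsilon> :: real assume \<epsilon>: "\<epsilon> > 0"
  \<comment> \<open>Compares the slope \<open>p\<close> with its linear prediction in the variable
    X. Since X has value a and derivative 1 at a, the derivative of \<open>m\<close> there is c - c
    = 0, so \<open>m k\<close> is o(k - a).\<close>
  define m where "m = (\<lambda>k. p k - c * (X k - a))"
  have "(X has_real_derivative 1) (at a)" using eventually_nhds_x_imp_x[OF X] Xa by simp
  then have "(m has_real_derivative c - c * 1) (at a)"
    unfolding m_def by (auto intro!: derivative_eq_intros p)
  then have "((\<lambda>k. (m k - m a) / (k - a)) \<longlongrightarrow> 0) (at a)"
    by (simp add: has_field_derivative_iff)
  then have "\<forall>\<^sub>F k in at a. \<bar>(m k - m a) / (k - a)\<bar> < \<epsilon> / 8"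
    using \<epsilon> by (intro order_tendstoD(2)[OF tendsto_rabs_zero]) auto
  then have "\<forall>\<^sub>F k in at a. \<bar>m k\<bar> \<le> \<epsilon> / 8 * \<bar>k - a\<bar>"
    using eventually_neq_at_within[of a]
    by eventually_elim (use Xa p(2) in \<open>auto simp: m_def abs_divide field_simps\<close>)
  then have m: "\<forall>\<^sub>F k in nhds a. \<bar>m k\<bar> \<le> \<epsilon> / 8 * \<bar>k - a\<bar>"
    unfolding eventually_nhds_conv_at using Xa p(2) by (simp add: m_def)
  have "(X' \<longlongrightarrow> 1) (nhds a)"
    using Xa by (metis isCont_def tendsto_at_iff_tendsto_nhds)
  then have X'1: "\<forall>\<^sub>F k in nhds a. 1 / 2 < X' k" "\<forall>\<^sub>F k in nhds a. X' k < 2"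
    by (auto dest: order_tendstoD(1)[of _ _ _ "1 / 2"] order_tendstoD(2)[of _ _ _ 2])
  have "\<forall>\<^sub>F k in nhds a. (X has_real_derivative X' k) (at k) \<and>
      (F has_real_derivative p k * X' k) (at k) \<and> f (X k) = F k \<and>
      \<bar>m k\<bar> \<le> \<epsilon> / 8 * \<bar>k - a\<bar> \<and> 1 / 2 < X' k \<and> X' k < 2"
    by (intro eventually_conj X F f m X'1)
  then obtain d where d: "d > 0" and
    D: "\<And>k. \<bar>k - a\<bar> < d \<Longrightarrow> (X has_real_derivative X' k) (at k)"
       "\<And>k. \<bar>k - a\<bar> < d \<Longrightarrow> (F has_real_derivative p k * X' k) (at k)"
       "\<And>k. \<bar>k - a\<bar> < d \<Longrightarrow> f (X k) = F k"
       "\<And>k. \<bar>k - a\<bar> < d \<Longrightarrow> \<bar>m k\<bar> \<le> \<epsilon> / 8 * \<bar>k - a\<bar>"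
       "\<And>k. \<bar>k - a\<bar> < d \<Longrightarrow> 1 / 2 < X' k"
       "\<And>k. \<bar>k - a\<bar> < d \<Longrightarrow> X' k < 2"
    unfolding eventually_nhds_metric dist_real_def by blast
  \<comment> \<open>Slope above 1/2 near a lets X control the parameter: |k - a| is at most 2 * |X k
    - a|.\<close>
  have mono: "v - u \<le> 2 * (X v - X u)" if "\<bar>u - a\<bar> < d" "\<bar>v - a\<bar> < d" "u \<le> v" for u v
  proof -
    have "2 * X u - u \<le> 2 * X v - v"
    proof (rule DERIV_nonneg_imp_nondecreasing[OF \<open>u \<le> v\<close>])
      fix z assume z: "u \<le> z" "z \<le> v"
      then have "\<bar>z - a\<bar> < d" using that by auto
      then show "\<exists>w. ((\<lambda>z. 2 * X z - z) has_real_derivative w) (at z) \<and> 0 \<le> w"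
        using D(5)[of z] by (intro exI[of _ "2 * X' z - 1"]) (auto intro!: derivative_eq_intros D(1))
    qed
    then show ?thesis by simp
  qed
  \<comment> \<open>The derivative of \<open>h\<close> is X' * m, so the mean value inequality
    bounds |h k - h a| by (\<epsilon> / 8) * 2 * |k - a|^2. Passing from k to X k costs a factor 4,
    whence the choice of \<epsilon> / 8.\<close>
  define h where "h = (\<lambda>k. F k - c / 2 * (X k - a)\<^sup>2)"
  have bound: "\<bar>h k - h a\<bar> \<le> \<epsilon> * (X k - a)\<^sup>2" if k: "\<bar>k - a\<bar> < d" for k
  proof -
    let ?r = "\<bar>k - a\<bar>"
    have "norm (h k - h a) \<le> (\<epsilon> / 8 * ?r * 2) * norm (k - a)"
    proof (rule field_differentiable_bound[of "cball a ?r" _ "\<lambda>z. X' z * m z"])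
      fix z assume "z \<in> cball a ?r"
      then have z: "\<bar>z - a\<bar> \<le> ?r" by (auto simp: dist_real_def)
      with k have z': "\<bar>z - a\<bar> < d" by simp
      have "(h has_real_derivative X' z * m z) (at z)"
        unfolding h_def m_def
        by (auto intro!: derivative_eq_intros D(1)[OF z'] D(2)[OF z'] simp: algebra_simps power2_eq_square)
      then show "(h has_real_derivative X' z * m z) (at z within cball a ?r)"
        by (rule has_field_derivative_at_within)
      have "\<bar>m z\<bar> \<le> \<epsilon> / 8 * ?r"
        using D(4)[OF z'] z \<epsilon> by (smt (verit) mult_left_mono divide_pos_pos)
      then have "\<bar>m z\<bar> * \<bar>X' z\<bar> \<le> \<epsilon> / 8 * ?r * 2"
        using D(5,6)[OF z'] by (intro mult_mono) auto
      then show "norm (X' z * m z) \<le> \<epsilon> / 8 * ?r * 2" by (simp add: abs_mult mult.commute)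
    qed (auto simp: dist_real_def)
    then have "\<bar>h k - h a\<bar> \<le> \<epsilon> / 4 * ?r\<^sup>2" by (simp add: power2_eq_square mult_ac)
    also have "?r \<le> 2 * \<bar>X k - a\<bar>"
      using mono[of k a] mono[of a k] k d Xa(1) by (cases "k \<le> a") auto
    then have "\<epsilon> / 4 * ?r\<^sup>2 \<le> \<epsilon> / 4 * (2 * \<bar>X k - a\<bar>)\<^sup>2"
      using \<epsilon> by (intro mult_left_mono power_mono) auto
    also have "\<dots> = \<epsilon> * (X k - a)\<^sup>2" by (simp add: power_mult_distrib)
    finally show ?thesis .
  qed
  have "\<bar>f y - (f a + c / 2 * (y - a)\<^sup>2)\<bar> \<le> \<epsilon> * (y - a)\<^sup>2" if y: "\<bar>y - a\<bar> < d / 4" for y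
  proof -
    \<comment> \<open>Moving k by d / 2 moves X by at least d / 4, so \<open>X l\<close> and
      \<open>X r\<close> enclose every y within d / 4 of a, while l and r stay inside the good
      neighbourhood.\<close>
    define l r where "l = a - d / 2" and "r = a + d / 2"
    have lr: "\<bar>l - a\<bar> < d" "\<bar>r - a\<bar> < d" "l \<le> a" "a \<le> r" "a - l = d / 2" "r - a = d / 2"
      unfolding l_def r_def using d by auto
    have "X l \<le> y" "y \<le> X r"
      using mono[of l a] mono[of a r] lr d y unfolding Xa(1) by (simp_all add: abs_if split: if_splits)
    moreover have "continuous_on {l..r} X"
      using lr by (intro continuous_at_imp_continuous_on ballI DERIV_isCont[OF D(1)]) auto
    ultimately have "\<exists>k\<ge>l. k \<le> r \<and> X k = y"
      using lr by (intro IVT') auto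
    then obtain k where k: "l \<le> k" "k \<le> r" "X k = y" by blast
    then have kd: "\<bar>k - a\<bar> < d" using lr d unfolding abs_less_iff by linarith
    have "h k - h a = f y - (f a + c / 2 * (y - a)\<^sup>2)"
      using D(3)[OF kd] D(3)[of a] d k Xa(1) by (simp add: h_def)
    then show ?thesis using bound[OF kd] k by simp
  qed
  then show "\<forall>\<^sub>F x in at a. norm (f x - (f a + c / 2 * (x - a)\<^sup>2)) \<le> \<epsilon> * norm ((x - a)\<^sup>2)"
    using d unfolding eventually_at dist_real_def by (intro exI[of _ "d / 4"]) auto
qed

text \<open>The derivative of arcsin increases on (0, 1), so the mean slope on [0, t] is less than
  that on [t, 1]. The strict bound serves to place the critical coupling above the lower end of the
  interval.\<close>

lemma arcsin_less_chord:
  assumes "0 < t" "t < 1"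
  shows "arcsin t < t * (pi / 2)"
proof -
  have cont: "continuous_on S arcsin" if "S \<subseteq> {-1..1}" for S
    using that continuous_on_arcsin' continuous_on_subset by blast
  have "\<exists>l z. 0 < z \<and> z < t \<and> (arcsin has_real_derivative l) (at z) \<and> arcsin t - arcsin 0 = (t - 0) * l"
    using assms by (intro MVT cont)
      (auto intro!: exI DERIV_arcsin simp: real_differentiable_def)
  then obtain l u where u: "0 < u" "u < t" "(arcsin has_real_derivative l) (at u)" "arcsin t = t * l"
    by auto
  have "\<exists>l z. t < z \<and> z < 1 \<and> (arcsin has_real_derivative l) (at z) \<and> arcsin 1 - arcsin t = (1 - t) * l"
    using assms by (intro MVT cont)
      (auto intro!: exI DERIV_arcsin simp: real_differentiable_def)
  then obtain l' v where v: "t < v" "v < 1" "(arcsin has_real_derivative l') (at v)"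
      "pi / 2 - arcsin t = (1 - t) * l'"
    by auto
  have "l = inverse (sqrt (1 - u\<^sup>2))" "l' = inverse (sqrt (1 - v\<^sup>2))"
    using u v assms by (auto intro!: DERIV_unique DERIV_arcsin)
  moreover have "u\<^sup>2 < v\<^sup>2" "v\<^sup>2 < 1"
    using u v assms by (auto intro!: power_strict_mono simp: abs_square_less_1)
  ultimately have "l < l'" by (auto intro!: less_imp_inverse_less)
  \<comment> \<open>Splitting t * l with weights 1 - t and t lets one copy of l be raised to l'; the
    result is t times the total rise (1 - t) * l' + t * l = pi / 2 of arcsin over [0, 1].\<close>
  have "arcsin t = (1 - t) * (t * l) + t * (t * l)"
    using u by (simp add: algebra_simps)
  also have "\<dots> < (1 - t) * (t * l') + t * (t * l)"
    using assms \<open>l < l'\<close> by simp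
  also have "\<dots> = t * ((1 - t) * l' + t * l)"
    by (simp add: algebra_simps)
  also have "\<dots> = t * (pi / 2)"
    using u(4) v(4) by simp
  finally show ?thesis .
qed

section \<open>Triangle inequality for oscillator actions\<close>

text \<open>Twice the classical action of the harmonic oscillator travelling from \<open>u\<close> to \<open>v\<close> in
  time \<open>\<psi>\<close>, which the classical path minimizes for \<open>\<psi> < pi\<close>; hence the triangle inequality below.\<close>

definition oscillator_action :: "real \<Rightarrow> 'a::real_inner \<Rightarrow> 'a \<Rightarrow> real" where
  "oscillator_action \<psi> u v = cot \<psi> * (u \<bullet> u + v \<bullet> v) - 2 * (u \<bullet> v) / sin \<psi>"

lemma oscillator_action_add_le:
  assumes "0 < \<psi>" "0 < \<phi>" "\<psi> + \<phi> < pi"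
  shows "oscillator_action (\<psi> + \<phi>) u w \<le> oscillator_action \<psi> u v + oscillator_action \<phi> v w"
proof -
  define A B C where "A = sin \<psi>" and "B = sin \<phi>" and "C = sin (\<psi> + \<phi>)"
  have pos: "A > 0" "B > 0" "C > 0"
    unfolding A_def B_def C_def using assms by (auto intro!: sin_gt_zero)
  \<comment> \<open>By the sine of a difference, changing the time changes the cotangent by a ratio
    of sines. \<open>uu\<close>, \<open>ww\<close> and \<open>vv\<close> supply the square
    coefficients of the quadratic form below.\<close>
  have uu: "cot \<psi> = cot (\<psi> + \<phi>) + B / (A * C)"
  proof -
    have "B = cos \<psi> * C - cos (\<psi> + \<phi>) * A"
      unfolding A_def B_def C_def using sin_diff[of "\<psi> + \<phi>" \<psi>] by (simp add: mult.commute)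
    then show ?thesis using pos by (simp add: cot_def flip: A_def C_def) (simp add: field_simps)
  qed
  have ww: "cot \<phi> = cot (\<psi> + \<phi>) + A / (B * C)"
  proof -
    have "A = cos \<phi> * C - cos (\<psi> + \<phi>) * B"
      unfolding A_def B_def C_def using sin_diff[of "\<psi> + \<phi>" \<phi>] by (simp add: mult.commute)
    then show ?thesis using pos by (simp add: cot_def flip: B_def C_def) (simp add: field_simps)
  qed
  have vv: "cot \<psi> + cot \<phi> = C / (A * B)"
    using pos unfolding cot_def A_def B_def C_def by (simp add: sin_add field_simps)
  \<comment> \<open>Completing the square: the defect in the triangle inequality is the square of q
    divided by A * B * C. It vanishes exactly when C v = B u + A w, that is, when v lies on the
    classical path from u to w at time \<psi>.\<close>
  define q where "q = C *\<^sub>R v - B *\<^sub>R u - A *\<^sub>R w"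
  have q: "q \<bullet> q = C\<^sup>2 * (v \<bullet> v) + B\<^sup>2 * (u \<bullet> u) + A\<^sup>2 * (w \<bullet> w)
      - 2 * B * C * (u \<bullet> v) - 2 * A * C * (v \<bullet> w) + 2 * A * B * (u \<bullet> w)"
    by (simp add: q_def inner_diff_left inner_diff_right inner_commute algebra_simps power2_eq_square)
  have "oscillator_action \<psi> u v + oscillator_action \<phi> v w - oscillator_action (\<psi> + \<phi>) u w
      = (cot \<psi> - cot (\<psi> + \<phi>)) * (u \<bullet> u) + (cot \<phi> - cot (\<psi> + \<phi>)) * (w \<bullet> w)
        + (cot \<psi> + cot \<phi>) * (v \<bullet> v) - 2 * (u \<bullet> v) / A - 2 * (v \<bullet> w) / B + 2 * (u \<bullet> w) / C"
    unfolding oscillator_action_def A_def[symmetric] B_def[symmetric] C_def[symmetric] by (simp add: algebra_simps)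
  also have "\<dots> = B / (A * C) * (u \<bullet> u) + A / (B * C) * (w \<bullet> w)
        + C / (A * B) * (v \<bullet> v) - 2 * (u \<bullet> v) / A - 2 * (v \<bullet> w) / B + 2 * (u \<bullet> w) / C"
    unfolding vv by (simp add: uu ww)
  also have "\<dots> = (q \<bullet> q) / (A * B * C)"
    unfolding q using pos by (simp add: field_simps power2_eq_square)
  also have "\<dots> \<ge> 0" using pos by simp
  finally show ?thesis by simp
qed

lemma oscillator_action_chain_le:
  assumes "n \<ge> 1" "\<And>\<mu>. \<mu> \<in> {1..n} \<Longrightarrow> 0 < \<psi> \<mu>" "(\<Sum>\<mu>=1..n. \<psi> \<mu>) < pi"
  shows "oscillator_action (\<Sum>\<mu>=1..n. \<psi> \<mu>) (t 1) (t (Suc n))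
    \<le> (\<Sum>\<mu>=1..n. oscillator_action (\<psi> \<mu>) (t \<mu>) (t (Suc \<mu>)))"
  using assms
proof (induction n rule: dec_induct)
  case base
  then show ?case by simp
next
  case (step n)
  have pos: "0 < \<psi> (Suc n)" "0 < (\<Sum>\<mu>=1..n. \<psi> \<mu>)"
    using step by (auto intro!: sum_pos)
  have lt: "(\<Sum>\<mu>=1..n. \<psi> \<mu>) < pi"
    using pos(1) step.prems(2) by simp
  have "oscillator_action (\<Sum>\<mu>=1..Suc n. \<psi> \<mu>) (t 1) (t (Suc (Suc n)))
      \<le> oscillator_action (\<Sum>\<mu>=1..n. \<psi> \<mu>) (t 1) (t (Suc n))
        + oscillator_action (\<psi> (Suc n)) (t (Suc n)) (t (Suc (Suc n)))"
    using oscillator_action_add_le[of "\<Sum>\<mu>=1..n. \<psi> \<mu>" "\<psi> (Suc n)"] pos step by simp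
  also have "oscillator_action (\<Sum>\<mu>=1..n. \<psi> \<mu>) (t 1) (t (Suc n))
      \<le> (\<Sum>\<mu>=1..n. oscillator_action (\<psi> \<mu>) (t \<mu>) (t (Suc \<mu>)))"
    using step.prems lt by (intro step.IH) auto
  finally show ?case by simp
qed

section \<open>The spin polygon and the concavity of its minimal energy\<close>

locale spin_polygon =
  fixes N :: nat and \<alpha> :: "nat \<Rightarrow> real"
  assumes N: "N > 2" and neg: "\<And>\<mu>. \<mu> \<in> {0<..<N} \<Longrightarrow> \<alpha> \<mu> < 0"
begin

definition E :: "real \<Rightarrow> real" where
  "E x = minimal_energy N (\<alpha>(0 := x))"

definition \<alpha>\<^sub>\<tau> :: real where
  "\<alpha>\<^sub>\<tau> = Min ((\<lambda>\<mu>. \<bar>\<alpha> \<mu>\<bar>) ` {0<..<N})"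

text \<open>Stationarity of the planar energy makes |\<alpha> \<mu>| * sin (\<psi> \<mu>) the same
  number k for all bonds, equal also to x * sin of the angle sum, where x is the variable coupling.
  With acute angles this gives \<psi> \<mu> as the arcsine summed here and x = k / sin (total_angle
  k).\<close>

definition total_angle :: "real \<Rightarrow> real" where
  "total_angle k = (\<Sum>\<mu>\<in>{0<..<N}. arcsin (k / \<bar>\<alpha> \<mu>\<bar>))"

definition total_angle' :: "real \<Rightarrow> real" where
  "total_angle' k = (\<Sum>\<mu>\<in>{0<..<N}. 1 / sqrt ((\<alpha> \<mu>)\<^sup>2 - k\<^sup>2))"

lemma bonds_nonempty: "{0<..<N} \<noteq> {}"
proof -
  have "1 \<in> {0<..<N}" using N by simp
  then show ?thesis by blast
qed

lemma coupling_pos: "\<mu> \<in> {0<..<N} \<Longrightarrow> 0 < \<bar>\<alpha> \<mu>\<bar>"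
  using neg[of \<mu>] by simp

lemma \<alpha>\<^sub>\<tau>_le: "\<mu> \<in> {0<..<N} \<Longrightarrow> \<alpha>\<^sub>\<tau> \<le> \<bar>\<alpha> \<mu>\<bar>"
  unfolding \<alpha>\<^sub>\<tau>_def by (intro Min_le) auto

lemma \<alpha>\<^sub>\<tau>_attained: obtains \<mu> where "\<mu> \<in> {0<..<N}" "\<alpha>\<^sub>\<tau> = \<bar>\<alpha> \<mu>\<bar>"
proof -
  have "\<alpha>\<^sub>\<tau> \<in> (\<lambda>\<mu>. \<bar>\<alpha> \<mu>\<bar>) ` {0<..<N}"
    unfolding \<alpha>\<^sub>\<tau>_def using bonds_nonempty by (intro Min_in) auto
  then show thesis using that by auto
qed

lemma \<alpha>\<^sub>\<tau>_pos: "\<alpha>\<^sub>\<tau> > 0"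
  by (rule \<alpha>\<^sub>\<tau>_attained) (simp only: coupling_pos)

lemma coupling_bounds:
  assumes "0 \<le> k" "k < \<alpha>\<^sub>\<tau>" "\<mu> \<in> {0<..<N}"
  shows "k < \<bar>\<alpha> \<mu>\<bar>" "k\<^sup>2 < (\<alpha> \<mu>)\<^sup>2" "- 1 < k / \<bar>\<alpha> \<mu>\<bar>" "k / \<bar>\<alpha> \<mu>\<bar> < 1"
proof -
  show 1: "k < \<bar>\<alpha> \<mu>\<bar>" using assms \<alpha>\<^sub>\<tau>_le by fastforce
  then show "k\<^sup>2 < (\<alpha> \<mu>)\<^sup>2" using assms(1) by (metis abs_of_nonneg power2_abs power_strict_mono zero_less_numeral)
  have "0 \<le> k / \<bar>\<alpha> \<mu>\<bar>" using assms(1) by (rule divide_nonneg_nonneg) simp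
  then show "- 1 < k / \<bar>\<alpha> \<mu>\<bar>" by linarith
  show "k / \<bar>\<alpha> \<mu>\<bar> < 1" using assms(1) 1 by auto
qed

text \<open>Isolates the variable coupling: for a fixed configuration the energy is affine in
  x.\<close>

lemma energy_split:
  "spin_polygon_energy N (\<alpha>(0 := x)) s
    = x * (s 0 \<bullet> s 1) - (\<Sum>\<mu>\<in>{0<..<N}. \<bar>\<alpha> \<mu>\<bar> * (s \<mu> \<bullet> s (Suc \<mu> mod N)))"
proof -
  have "{..<N} = insert 0 {0<..<N}" using N by auto
  then have "spin_polygon_energy N (\<alpha>(0 := x)) s
      = x * (s 0 \<bullet> s 1) + (\<Sum>\<mu>\<in>{0<..<N}. \<alpha> \<mu> * (s \<mu> \<bullet> s (Suc \<mu> mod N)))"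
    using N by (simp add: spin_polygon_energy_def)
  also have "(\<Sum>\<mu>\<in>{0<..<N}. \<alpha> \<mu> * (s \<mu> \<bullet> s (Suc \<mu> mod N)))
      = - (\<Sum>\<mu>\<in>{0<..<N}. \<bar>\<alpha> \<mu>\<bar> * (s \<mu> \<bullet> s (Suc \<mu> mod N)))"
    unfolding sum_negf[symmetric]
  proof (intro sum.cong refl)
    fix \<mu> assume "\<mu> \<in> {0<..<N}"
    then show "\<alpha> \<mu> * (s \<mu> \<bullet> s (Suc \<mu> mod N)) = - (\<bar>\<alpha> \<mu>\<bar> * (s \<mu> \<bullet> s (Suc \<mu> mod N)))"
      using neg[of \<mu>] by simp
  qed
  finally show ?thesis by (simp only: diff_conv_add_uminus)
qed

lemma E_le:
  assumes "s \<in> spin_configurations N"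
  shows "E x \<le> spin_polygon_energy N (\<alpha>(0 := x)) s"
  using minimal_energy_attained[of N "\<alpha>(0 := x)"] assms N unfolding E_def
  by (metis gr_implies_not0 neq0_conv)

lemma E_attained:
  obtains s where "s \<in> spin_configurations N" "E x = spin_polygon_energy N (\<alpha>(0 := x)) s"
  using minimal_energy_attained[of N "\<alpha>(0 := x)"] N unfolding E_def
  by (metis gr_implies_not0 neq0_conv)

text \<open>A minimizer for the averaged coupling serves as trial configuration for both x and y,
  and its energy is affine in the coupling.\<close>

lemma E_concave: "concave_on UNIV E"
  unfolding concave_on_iff
proof (intro conjI ballI allI impI)
  fix x y u v :: real
  assume uv: "0 \<le> u" "0 \<le> v" "u + v = 1"
  obtain s where s: "s \<in> spin_configurations N"
      "E (u *\<^sub>R x + v *\<^sub>R y) = spin_polygon_energy N (\<alpha>(0 := u *\<^sub>R x + v *\<^sub>R y)) s"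
    by (rule E_attained)
  define c where "c = (\<Sum>\<mu>\<in>{0<..<N}. \<bar>\<alpha> \<mu>\<bar> * (s \<mu> \<bullet> s (Suc \<mu> mod N)))"
  have "u * E x + v * E y \<le> u * (x * (s 0 \<bullet> s 1) - c) + v * (y * (s 0 \<bullet> s 1) - c)"
    using E_le[OF s(1)] uv unfolding energy_split c_def by (intro add_mono mult_left_mono) auto
  also have "\<dots> = (u * x + v * y) * (s 0 \<bullet> s 1) - (u + v) * c"
    by (simp add: algebra_simps)
  also have "\<dots> = E (u *\<^sub>R x + v *\<^sub>R y)"
    unfolding s(2) energy_split c_def using uv by simp
  finally show "u * E x + v * E y \<le> E (u *\<^sub>R x + v *\<^sub>R y)" .
qed simp

section \<open>Upper and lower bounds for the minimal energy\<close>

text \<open>Trial configuration: unit vectors in a coordinate plane, turned by \<psi> \<mu> across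
  bond \<mu>, so that the closing bond spans the whole angle sum.\<close>

lemma E_le_planar:
  "E x \<le> x * cos (\<Sum>\<mu>\<in>{0<..<N}. \<psi> \<mu>) - (\<Sum>\<mu>\<in>{0<..<N}. \<bar>\<alpha> \<mu>\<bar> * cos (\<psi> \<mu>))"
proof -
  define e :: "real \<Rightarrow> real ^ 3" where "e = (\<lambda>t. vector [cos t, sin t, 0])"
  have e: "e t \<bullet> e t' = cos (t - t')" for t t'
    by (simp add: e_def inner_vec_def sum_3 cos_diff)
  define \<theta> where "\<theta> = (\<lambda>m. \<Sum>\<mu>\<in>{0<..<m}. \<psi> \<mu>)"
  \<comment> \<open>Bond N - 1 ends at index 0, so spin 0 receives the last angle
    \<open>\<theta> N\<close> rather than \<open>\<theta> 0\<close>; spin 1 sits at angle 0 because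
    its sum is empty.\<close>
  define s where "s = (\<lambda>\<mu>. e (\<theta> (if \<mu> = 0 then N else \<mu>)))"
  have "\<theta> (Suc 0) = 0"
    by (auto simp: \<theta>_def intro!: sum.neutral)
  then have 1: "s 0 \<bullet> s 1 = cos (\<Sum>\<mu>\<in>{0<..<N}. \<psi> \<mu>)"
    by (simp add: s_def e) (simp add: \<theta>_def)
  have 2: "s \<mu> \<bullet> s (Suc \<mu> mod N) = cos (\<psi> \<mu>)" if "\<mu> \<in> {0<..<N}" for \<mu>
  proof -
    have "{0<..<Suc \<mu>} = insert \<mu> {0<..<\<mu>}" using that by auto
    then have "\<theta> (Suc \<mu>) = \<theta> \<mu> + \<psi> \<mu>" by (simp add: \<theta>_def)
    moreover have "s (Suc \<mu> mod N) = e (\<theta> (Suc \<mu>))"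
      using that by (cases "Suc \<mu> = N") (auto simp: s_def)
    ultimately show ?thesis using that by (simp add: s_def e)
  qed
  have "s \<in> spin_configurations N"
    by (simp add: spin_configurations_def s_def norm_eq_sqrt_inner e)
  from E_le[OF this] show ?thesis
    unfolding energy_split 1 by (simp add: 2)
qed

lemma cos_arcsin_coupling:
  assumes "0 \<le> k" "k < \<alpha>\<^sub>\<tau>" "\<mu> \<in> {0<..<N}"
  shows "\<bar>\<alpha> \<mu>\<bar> * cos (arcsin (k / \<bar>\<alpha> \<mu>\<bar>)) = sqrt ((\<alpha> \<mu>)\<^sup>2 - k\<^sup>2)"
proof -
  have "\<bar>\<alpha> \<mu>\<bar> * cos (arcsin (k / \<bar>\<alpha> \<mu>\<bar>)) = sqrt ((\<alpha> \<mu>)\<^sup>2) * sqrt (1 - (k / \<bar>\<alpha> \<mu>\<bar>)\<^sup>2)"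
    using coupling_bounds[OF assms] by (subst cos_arcsin) auto
  also have "\<dots> = sqrt ((\<alpha> \<mu>)\<^sup>2 - k\<^sup>2)"
    unfolding real_sqrt_mult[symmetric] using neg[OF assms(3)]
    by (simp add: power_divide field_simps)
  finally show ?thesis .
qed

text \<open>The planar bound at the stationary angles for k is affine in x. By
  \<open>E_parametrized\<close> it touches E at x = k / sin (total_angle k) if k > 0 and the total
  angle is below pi; at total angle pi / 2 it is constant and bounds E globally.\<close>

lemma E_le_tangent:
  assumes "0 \<le> k" "k < \<alpha>\<^sub>\<tau>"
  shows "E x \<le> x * cos (total_angle k) - (\<Sum>\<mu>\<in>{0<..<N}. sqrt ((\<alpha> \<mu>)\<^sup>2 - k\<^sup>2))"
  using E_le_planar[of x "\<lambda>\<mu>. arcsin (k / \<bar>\<alpha> \<mu>\<bar>)"]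
  by (simp add: total_angle_def cos_arcsin_coupling[OF assms])

text \<open>For the lower bound, k times the action of bond \<mu> is a constant minus 2 * |\<alpha>
  \<mu>| times its scalar product, because k / sin (\<psi> \<mu>) = |\<alpha> \<mu>|; likewise the
  closing pair carries the coupling k / sin (total_angle k). The chain inequality between these
  actions is then the claim, for arbitrary spins in space.\<close>

lemma E_parametrized:
  assumes k: "0 < k" "k < \<alpha>\<^sub>\<tau>" and angle: "total_angle k < pi"
  shows "E (k / sin (total_angle k))
    = k * cot (total_angle k) - (\<Sum>\<mu>\<in>{0<..<N}. sqrt ((\<alpha> \<mu>)\<^sup>2 - k\<^sup>2))"
proof (rule antisym)
  show "E (k / sin (total_angle k))
      \<le> k * cot (total_angle k) - (\<Sum>\<mu>\<in>{0<..<N}. sqrt ((\<alpha> \<mu>)\<^sup>2 - k\<^sup>2))"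
    using E_le_tangent[of k "k / sin (total_angle k)"] k by (simp add: cot_def)
next
  define \<psi> where "\<psi> = (\<lambda>\<mu>. arcsin (k / \<bar>\<alpha> \<mu>\<bar>))"
  obtain s where s: "s \<in> spin_configurations N"
      "E (k / sin (total_angle k)) = spin_polygon_energy N (\<alpha>(0 := k / sin (total_angle k))) s"
    by (rule E_attained)
  \<comment> \<open>Reducing indices modulo N opens the polygon into a chain from \<open>s 1\<close>
    to t N = s 0.\<close>
  define t where "t = (\<lambda>\<mu>. s (\<mu> mod N))"
  have unit: "t \<mu> \<bullet> t \<mu> = 1" for \<mu>
    using s(1) N by (simp add: t_def spin_configurations_def dot_square_norm)
  have \<psi>: "0 < \<psi> \<mu>" "k * oscillator_action (\<psi> \<mu>) (t \<mu>) (t (Suc \<mu>))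
      = 2 * sqrt ((\<alpha> \<mu>)\<^sup>2 - k\<^sup>2) - 2 * (\<bar>\<alpha> \<mu>\<bar> * (s \<mu> \<bullet> s (Suc \<mu> mod N)))"
    if \<mu>: "\<mu> \<in> {0<..<N}" for \<mu>
  proof -
    note b = coupling_bounds[OF less_imp_le[OF k(1)] k(2) \<mu>]
    have "0 < k / \<bar>\<alpha> \<mu>\<bar>" by (intro divide_pos_pos k(1) coupling_pos \<mu>)
    then show "0 < \<psi> \<mu>" unfolding \<psi>_def using b arcsin_less_arcsin[of 0 "k / \<bar>\<alpha> \<mu>\<bar>"] by simp
    have sin: "sin (\<psi> \<mu>) = k / \<bar>\<alpha> \<mu>\<bar>" using b by (simp add: \<psi>_def)
    then have "k * cot (\<psi> \<mu>) = \<bar>\<alpha> \<mu>\<bar> * cos (\<psi> \<mu>)" "k / sin (\<psi> \<mu>) = \<bar>\<alpha> \<mu>\<bar>"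
      using k(1) neg[OF \<mu>] by (auto simp: cot_def)
    then have "k * cot (\<psi> \<mu>) = sqrt ((\<alpha> \<mu>)\<^sup>2 - k\<^sup>2)" "k / sin (\<psi> \<mu>) = \<bar>\<alpha> \<mu>\<bar>"
      using cos_arcsin_coupling[of k \<mu>] k \<mu> by (auto simp: \<psi>_def)
    moreover have "k * oscillator_action (\<psi> \<mu>) (t \<mu>) (t (Suc \<mu>))
        = 2 * (k * cot (\<psi> \<mu>)) - 2 * ((k / sin (\<psi> \<mu>)) * (t \<mu> \<bullet> t (Suc \<mu>)))"
      by (simp add: oscillator_action_def unit right_diff_distrib)
    ultimately show "k * oscillator_action (\<psi> \<mu>) (t \<mu>) (t (Suc \<mu>))
        = 2 * sqrt ((\<alpha> \<mu>)\<^sup>2 - k\<^sup>2) - 2 * (\<bar>\<alpha> \<mu>\<bar> * (s \<mu> \<bullet> s (Suc \<mu> mod N)))"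
      using \<mu> by (simp add: t_def)
  qed
  have range: "{1..N - 1} = {0<..<N}" using N by auto
  have "oscillator_action (\<Sum>\<mu>=1..N - 1. \<psi> \<mu>) (t 1) (t (Suc (N - 1)))
      \<le> (\<Sum>\<mu>=1..N - 1. oscillator_action (\<psi> \<mu>) (t \<mu>) (t (Suc \<mu>)))"
    by (rule oscillator_action_chain_le)
       (use N \<psi>(1) angle in \<open>auto simp: range total_angle_def \<psi>_def simp del: One_nat_def\<close>)
  then have "oscillator_action (total_angle k) (s 1) (s 0)
      \<le> (\<Sum>\<mu>\<in>{0<..<N}. oscillator_action (\<psi> \<mu>) (t \<mu>) (t (Suc \<mu>)))"
    unfolding range using N by (simp add: t_def total_angle_def \<psi>_def)
  then have "k * oscillator_action (total_angle k) (s 1) (s 0)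
      \<le> k * (\<Sum>\<mu>\<in>{0<..<N}. oscillator_action (\<psi> \<mu>) (t \<mu>) (t (Suc \<mu>)))"
    using k(1) by simp
  also have "\<dots> = (\<Sum>\<mu>\<in>{0<..<N}. 2 * sqrt ((\<alpha> \<mu>)\<^sup>2 - k\<^sup>2) - 2 * (\<bar>\<alpha> \<mu>\<bar> * (s \<mu> \<bullet> s (Suc \<mu> mod N))))"
    unfolding sum_distrib_left by (intro sum.cong refl \<psi>(2))
  also have "\<dots> = 2 * (\<Sum>\<mu>\<in>{0<..<N}. sqrt ((\<alpha> \<mu>)\<^sup>2 - k\<^sup>2))
      - 2 * (\<Sum>\<mu>\<in>{0<..<N}. \<bar>\<alpha> \<mu>\<bar> * (s \<mu> \<bullet> s (Suc \<mu> mod N)))"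
    by (simp add: sum_subtractf sum_distrib_left)
  finally have "k * oscillator_action (total_angle k) (s 1) (s 0)
      \<le> 2 * (\<Sum>\<mu>\<in>{0<..<N}. sqrt ((\<alpha> \<mu>)\<^sup>2 - k\<^sup>2))
        - 2 * (\<Sum>\<mu>\<in>{0<..<N}. \<bar>\<alpha> \<mu>\<bar> * (s \<mu> \<bullet> s (Suc \<mu> mod N)))" .
  moreover have "k * oscillator_action (total_angle k) (s 1) (s 0)
      = 2 * (k * cot (total_angle k)) - 2 * (k / sin (total_angle k) * (s 0 \<bullet> s 1))"
    using unit[of 0] unit[of 1] N
    by (simp add: oscillator_action_def t_def right_diff_distrib inner_commute)
  ultimately show "k * cot (total_angle k) - (\<Sum>\<mu>\<in>{0<..<N}. sqrt ((\<alpha> \<mu>)\<^sup>2 - k\<^sup>2))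
      \<le> E (k / sin (total_angle k))"
    unfolding s(2) energy_split by simp
qed

section \<open>Total angle and the critical coupling\<close>

lemma total_angle_strict_mono:
  assumes "0 \<le> k" "k < l" "l \<le> \<alpha>\<^sub>\<tau>"
  shows "total_angle k < total_angle l"
  unfolding total_angle_def
proof (rule sum_strict_mono)
  fix \<mu> assume \<mu>: "\<mu> \<in> {0<..<N}"
  have "0 \<le> k / \<bar>\<alpha> \<mu>\<bar>" "k / \<bar>\<alpha> \<mu>\<bar> < l / \<bar>\<alpha> \<mu>\<bar>" "l / \<bar>\<alpha> \<mu>\<bar> \<le> 1"
    using assms \<alpha>\<^sub>\<tau>_le[OF \<mu>] neg[OF \<mu>] by (auto simp: divide_simps)
  then show "arcsin (k / \<bar>\<alpha> \<mu>\<bar>) < arcsin (l / \<bar>\<alpha> \<mu>\<bar>)"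
    by (intro arcsin_less_arcsin) linarith+
qed (use bonds_nonempty in auto)

lemma total_angle_0: "total_angle 0 = 0"
  by (simp add: total_angle_def)

lemma total_angle_\<alpha>\<^sub>\<tau>: "total_angle \<alpha>\<^sub>\<tau> > pi / 2"
proof -
  obtain \<nu> where \<nu>: "\<nu> \<in> {0<..<N}" "\<alpha>\<^sub>\<tau> = \<bar>\<alpha> \<nu>\<bar>" by (rule \<alpha>\<^sub>\<tau>_attained)
  have "0 < (\<Sum>\<mu>\<in>{0<..<N} - {\<nu>}. arcsin (\<alpha>\<^sub>\<tau> / \<bar>\<alpha> \<mu>\<bar>))"
  proof (rule sum_pos)
    \<comment> \<open>N > 2 provides a bond besides the weakest one \<nu>. Bond \<nu> alone
      contributes pi / 2, and any other bond pushes the total angle beyond it.\<close>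
    have "(if \<nu> = 1 then 2 else 1) \<in> {0<..<N} - {\<nu>}" using N by auto
    then show "{0<..<N} - {\<nu>} \<noteq> {}" by blast
    fix \<mu> assume "\<mu> \<in> {0<..<N} - {\<nu>}"
    then have "0 < \<alpha>\<^sub>\<tau> / \<bar>\<alpha> \<mu>\<bar>" "\<alpha>\<^sub>\<tau> / \<bar>\<alpha> \<mu>\<bar> \<le> 1"
      using \<alpha>\<^sub>\<tau>_pos \<alpha>\<^sub>\<tau>_le[of \<mu>] coupling_pos[of \<mu>] by (simp_all add: divide_le_eq_1)
    then show "0 < arcsin (\<alpha>\<^sub>\<tau> / \<bar>\<alpha> \<mu>\<bar>)"
      using arcsin_less_arcsin[of 0 "\<alpha>\<^sub>\<tau> / \<bar>\<alpha> \<mu>\<bar>"] by simp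
  qed simp
  moreover have "arcsin (\<alpha>\<^sub>\<tau> / \<bar>\<alpha> \<nu>\<bar>) = pi / 2" using \<nu> \<alpha>\<^sub>\<tau>_pos by simp
  ultimately show ?thesis
    unfolding total_angle_def using \<nu>(1) by (simp add: sum.remove)
qed

lemma continuous_on_total_angle: "continuous_on {0..\<alpha>\<^sub>\<tau>} total_angle"
  unfolding total_angle_def
proof (intro continuous_intros ballI)
  fix \<mu> k assume \<mu>: "\<mu> \<in> {0<..<N}" and "k \<in> {0..\<alpha>\<^sub>\<tau>}"
  then show "\<bar>\<alpha> \<mu>\<bar> \<noteq> 0" "- 1 \<le> k / \<bar>\<alpha> \<mu>\<bar> \<and> k / \<bar>\<alpha> \<mu>\<bar> \<le> 1"
    using \<alpha>\<^sub>\<tau>_le[OF \<mu>] neg[OF \<mu>] by (auto simp: divide_simps)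
qed

lemma critical_coupling_unique:
  assumes "0 \<le> k" "k \<le> \<alpha>\<^sub>\<tau>" "0 \<le> l" "l \<le> \<alpha>\<^sub>\<tau>" "total_angle k = total_angle l"
  shows "k = l"
  using total_angle_strict_mono[of k l] total_angle_strict_mono[of l k] assms by linarith

lemma critical_coupling_exists:
  obtains a where "0 < a" "a < \<alpha>\<^sub>\<tau>" "total_angle a = pi / 2"
proof -
  obtain a where a: "0 \<le> a" "a \<le> \<alpha>\<^sub>\<tau>" "total_angle a = pi / 2"
    using IVT'[of total_angle 0 "pi / 2" \<alpha>\<^sub>\<tau>] total_angle_0 total_angle_\<alpha>\<^sub>\<tau> \<alpha>\<^sub>\<tau>_pos
      continuous_on_total_angle by auto
  moreover have "a \<noteq> 0" "a \<noteq> \<alpha>\<^sub>\<tau>" using a(3) total_angle_0 total_angle_\<alpha>\<^sub>\<tau> by auto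
  ultimately show thesis by (intro that[of a]) auto
qed

lemma has_derivative_total_angle:
  assumes "0 \<le> k" "k < \<alpha>\<^sub>\<tau>"
  shows "(total_angle has_real_derivative total_angle' k) (at k)"
  unfolding total_angle_def total_angle'_def
proof (rule DERIV_sum)
  fix \<mu> assume \<mu>: "\<mu> \<in> {0<..<N}"
  note b = coupling_bounds[OF assms \<mu>]
  have "((\<lambda>k. arcsin (k / \<bar>\<alpha> \<mu>\<bar>)) has_real_derivative
      inverse (sqrt (1 - (k / \<bar>\<alpha> \<mu>\<bar>)\<^sup>2)) * (1 / \<bar>\<alpha> \<mu>\<bar>)) (at k)"
    by (rule DERIV_chain2[OF DERIV_arcsin]) (use b DERIV_cdivide[OF DERIV_ident] in auto)
  also have "inverse (sqrt (1 - (k / \<bar>\<alpha> \<mu>\<bar>)\<^sup>2)) * (1 / \<bar>\<alpha> \<mu>\<bar>)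
      = 1 / (\<bar>\<alpha> \<mu>\<bar> * cos (arcsin (k / \<bar>\<alpha> \<mu>\<bar>)))"
    using b by (subst cos_arcsin) (simp_all add: divide_inverse mult.commute)
  also have "\<dots> = 1 / sqrt ((\<alpha> \<mu>)\<^sup>2 - k\<^sup>2)"
    using cos_arcsin_coupling[OF assms \<mu>] by simp
  finally show "((\<lambda>k. arcsin (k / \<bar>\<alpha> \<mu>\<bar>)) has_real_derivative 1 / sqrt ((\<alpha> \<mu>)\<^sup>2 - k\<^sup>2)) (at k)" .
qed

text \<open>The derivative is again a multiple of \<open>total_angle'\<close>, so it merges with
  that of k * cot (total_angle k).\<close>

lemma has_derivative_sum_sqrt:
  assumes "0 \<le> k" "k < \<alpha>\<^sub>\<tau>"
  shows "((\<lambda>k. \<Sum>\<mu>\<in>{0<..<N}. sqrt ((\<alpha> \<mu>)\<^sup>2 - k\<^sup>2)) has_real_derivative - k * total_angle' k) (at k)"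
proof -
  have "((\<lambda>k. \<Sum>\<mu>\<in>{0<..<N}. sqrt ((\<alpha> \<mu>)\<^sup>2 - k\<^sup>2)) has_real_derivative
      (\<Sum>\<mu>\<in>{0<..<N}. - k * (1 / sqrt ((\<alpha> \<mu>)\<^sup>2 - k\<^sup>2)))) (at k)"
  proof (rule DERIV_sum)
    fix \<mu> assume "\<mu> \<in> {0<..<N}"
    then have "(\<alpha> \<mu>)\<^sup>2 - k\<^sup>2 > 0" using coupling_bounds[OF assms] by simp
    then show "((\<lambda>k. sqrt ((\<alpha> \<mu>)\<^sup>2 - k\<^sup>2)) has_real_derivative - k * (1 / sqrt ((\<alpha> \<mu>)\<^sup>2 - k\<^sup>2))) (at k)"
      by (auto intro!: derivative_eq_intros simp: field_simps)
  qed
  then show ?thesis by (simp only: total_angle'_def sum_distrib_left)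
qed

lemma isCont_total_angle':
  assumes "0 \<le> k" "k < \<alpha>\<^sub>\<tau>"
  shows "isCont total_angle' k"
  unfolding total_angle'_def
proof (intro continuous_intros)
  fix \<mu> assume "\<mu> \<in> {0<..<N}"
  then show "sqrt ((\<alpha> \<mu>)\<^sup>2 - k\<^sup>2) \<noteq> 0" using coupling_bounds[OF assms] by fastforce
qed

section \<open>Behaviour of the energy at the critical coupling\<close>

text \<open>At a the sine is 1 and the cosine 0, so the curve X passes through a with unit
  derivative. The slope cos (total_angle k) vanishes there, and its derivative at a is the constant
  c of the expansion.\<close>

lemma E_second_order:
  assumes a: "0 < a" "a < \<alpha>\<^sub>\<tau>" "total_angle a = pi / 2"
  shows "(\<lambda>x. E x - (E a + - total_angle' a / 2 * (x - a)\<^sup>2)) \<in> o[at a](\<lambda>x. (x - a)\<^sup>2)"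
proof (rule second_order_expansion_reparam)
  define X where "X = (\<lambda>k. k / sin (total_angle k))"
  define X' where "X' = (\<lambda>k. (sin (total_angle k) - k * (cos (total_angle k) * total_angle' k)) / (sin (total_angle k))\<^sup>2)"
  define F where "F = (\<lambda>k. k * cot (total_angle k) - (\<Sum>\<mu>\<in>{0<..<N}. sqrt ((\<alpha> \<mu>)\<^sup>2 - k\<^sup>2)))"
  note \<Psi>' = has_derivative_total_angle[of a]
  have "(total_angle \<longlongrightarrow> total_angle a) (nhds a)"
    using DERIV_isCont[OF \<Psi>'] a by (metis isCont_def less_imp_le tendsto_at_iff_tendsto_nhds)
  then have "\<forall>\<^sub>F k in nhds a. total_angle k < pi"
    by (rule order_tendstoD) (simp add: a)
  moreover have "\<forall>\<^sub>F k in nhds a. k \<in> {0<..<\<alpha>\<^sub>\<tau>}"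
    using a by (intro eventually_nhds_in_open) auto
  ultimately have near: "\<forall>\<^sub>F k in nhds a. 0 < k \<and> k < \<alpha>\<^sub>\<tau> \<and> total_angle k < pi"
    by eventually_elim auto
  have sin: "0 < sin (total_angle k)" if "0 < k \<and> k < \<alpha>\<^sub>\<tau> \<and> total_angle k < pi" for k
    using total_angle_strict_mono[of 0 k] that by (intro sin_gt_zero) (auto simp: total_angle_0)
  show "\<forall>\<^sub>F k in nhds a. (X has_real_derivative X' k) (at k)"
    using near
  proof eventually_elim
    case (elim k)
    then show ?case
      unfolding X_def X'_def using sin[OF elim]
      by (auto intro!: derivative_eq_intros has_derivative_total_angle simp: field_simps power2_eq_square)
  qed
  show "\<forall>\<^sub>F k in nhds a. (F has_real_derivative cos (total_angle k) * X' k) (at k)"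
    using near
  proof eventually_elim
    case (elim k)
    define S C W where "S = sin (total_angle k)" and "C = cos (total_angle k)" and "W = total_angle' k"
    have S: "S > 0" and "S\<^sup>2 + C\<^sup>2 = 1" unfolding S_def C_def using sin[OF elim] by auto
    have "((\<lambda>k. cot (total_angle k)) has_real_derivative - inverse (S\<^sup>2) * W) (at k)"
      unfolding S_def W_def using elim sin[OF elim]
      by (intro DERIV_chain2[OF DERIV_cot] has_derivative_total_angle) auto
    from DERIV_mult[OF DERIV_ident this]
    have "((\<lambda>k. k * cot (total_angle k)) has_real_derivative C / S + k * (- inverse (S\<^sup>2) * W)) (at k)"
      by (simp add: cot_def S_def C_def mult.commute add.commute)
    from DERIV_diff[OF this has_derivative_sum_sqrt]
    have "(F has_real_derivative (C / S + k * (- inverse (S\<^sup>2) * W)) - (- k * W)) (at k)"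
      using elim unfolding F_def W_def by simp
    \<comment> \<open>The terms with W combine through 1 - S^2 = C^2; then a factor C splits off and
      leaves X', so C is the slope of the energy with respect to the coupling.\<close>
    also have "(C / S + k * (- inverse (S\<^sup>2) * W)) - (- k * W) = C / S - k * W * (1 - S\<^sup>2) / S\<^sup>2"
      using S by (simp add: field_simps)
    also have "1 - S\<^sup>2 = C\<^sup>2" using \<open>S\<^sup>2 + C\<^sup>2 = 1\<close> by simp
    also have "C / S - k * W * C\<^sup>2 / S\<^sup>2 = C * X' k"
      unfolding X'_def S_def[symmetric] C_def[symmetric] W_def[symmetric]
      using S by (simp add: field_simps power2_eq_square)
    finally show ?case by (simp add: C_def)
  qed
  show "\<forall>\<^sub>F k in nhds a. E (X k) = F k"
    using near by eventually_elim (simp add: X_def F_def E_parametrized)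
  show "X a = a" "X' a = 1" by (simp_all add: X_def X'_def a)
  show "isCont X' a"
    unfolding X'_def using a(1,2) DERIV_isCont[OF \<Psi>'] isCont_total_angle'[of a]
    by (intro continuous_intros) (auto simp: a(3))
  show "((\<lambda>k. cos (total_angle k)) has_real_derivative - total_angle' a) (at a)"
    using a(1,2) by (auto intro!: derivative_eq_intros \<Psi>' simp: a(3))
qed (simp add: a)

text \<open>Summing the strict chord bound of arcsin over the bonds turns the equation for a into pi
  / 2 < a * ?S * (pi / 2).\<close>

lemma harmonic_coupling_less:
  assumes a: "0 < a" "a < \<alpha>\<^sub>\<tau>" "total_angle a = pi / 2"
  shows "inverse (\<Sum>\<mu>\<in>{0<..<N}. inverse \<bar>\<alpha> \<mu>\<bar>) < a"
proof -
  let ?S = "\<Sum>\<mu>\<in>{0<..<N}. inverse \<bar>\<alpha> \<mu>\<bar>"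
  have "pi / 2 = (\<Sum>\<mu>\<in>{0<..<N}. arcsin (a / \<bar>\<alpha> \<mu>\<bar>))" using a by (simp add: total_angle_def)
  also have "\<dots> < (\<Sum>\<mu>\<in>{0<..<N}. a / \<bar>\<alpha> \<mu>\<bar> * (pi / 2))"
  proof (rule sum_strict_mono)
    fix \<mu> assume \<mu>: "\<mu> \<in> {0<..<N}"
    show "arcsin (a / \<bar>\<alpha> \<mu>\<bar>) < a / \<bar>\<alpha> \<mu>\<bar> * (pi / 2)"
      using coupling_bounds(4)[of a \<mu>] a \<mu>
      by (intro arcsin_less_chord divide_pos_pos coupling_pos) auto
  qed (use bonds_nonempty in auto)
  also have "\<dots> = a * ?S * (pi / 2)"
    by (simp only: divide_inverse sum_distrib_left sum_distrib_right)
  finally have "1 < a * ?S" by simp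
  moreover have "0 < ?S" using bonds_nonempty neg by (intro sum_pos) fastforce+
  ultimately show ?thesis by (simp add: field_simps)
qed

lemma total_angle'_powr:
  assumes "0 \<le> k" "k < \<alpha>\<^sub>\<tau>"
  shows "(\<Sum>\<mu>\<in>{0<..<N}. ((\<alpha> \<mu>)\<^sup>2 - k\<^sup>2) powr (- 1 / 2)) = total_angle' k"
  unfolding total_angle'_def
proof (intro sum.cong refl)
  fix \<mu> assume "\<mu> \<in> {0<..<N}"
  then have "(\<alpha> \<mu>)\<^sup>2 - k\<^sup>2 > 0" using coupling_bounds[OF assms] by simp
  then show "((\<alpha> \<mu>)\<^sup>2 - k\<^sup>2) powr (- 1 / 2) = 1 / sqrt ((\<alpha> \<mu>)\<^sup>2 - k\<^sup>2)"
    by (simp add: powr_minus_divide powr_half_sqrt)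
qed

lemma total_angle'_pos:
  assumes "0 \<le> k" "k < \<alpha>\<^sub>\<tau>"
  shows "0 < total_angle' k"
  unfolding total_angle'_def
  using coupling_bounds(2)[OF assms] bonds_nonempty by (intro sum_pos) auto

end

theorem mainTheorem9:
  fixes N :: nat and \<alpha> :: "nat \<Rightarrow> real"
    and E :: "real \<Rightarrow> real" and \<alpha>\<^sub>\<tau> \<alpha>\<^sub>c :: real
  assumes "N > 2"
    and "\<forall>\<mu>\<in>{0<..<N}. \<alpha> \<mu> < 0"
  defines "E \<equiv> \<lambda>\<alpha>\<^sub>0. minimal_energy N (\<alpha>(0 := \<alpha>\<^sub>0))"
    and "\<alpha>\<^sub>\<tau> \<equiv> Min ((\<lambda>\<mu>. \<bar>\<alpha> \<mu>\<bar>) ` {0<..<N})"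
    and "\<alpha>\<^sub>c \<equiv> inverse (\<Sum>\<mu>\<in>{0<..<N}. inverse \<bar>\<alpha> \<mu>\<bar>)"
  shows "\<exists>a.
    (\<forall>b. b \<in> {0..\<alpha>\<^sub>\<tau>} \<and> pi / 2 = (\<Sum>\<mu>\<in>{0<..<N}. arcsin (b / \<bar>\<alpha> \<mu>\<bar>)) \<longleftrightarrow> b = a) \<and>
    a < \<alpha>\<^sub>\<tau> \<and>
    {x \<in> {\<alpha>\<^sub>c<..<\<alpha>\<^sub>\<tau>}. local_extremum_at E x} = {a} \<and>
    local_max_at E a \<and>
    (\<forall>x\<in>{\<alpha>\<^sub>c<..<\<alpha>\<^sub>\<tau>}. E x \<le> E a) \<and>
    (let E_max = - (\<Sum>\<mu>\<in>{0<..<N}. sqrt ((\<alpha> \<mu>)\<^sup>2 - a\<^sup>2));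
         e\<^sub>2 = 1 / 2 * (\<Sum>\<mu>\<in>{0<..<N}. ((\<alpha> \<mu>)\<^sup>2 - a\<^sup>2) powr (- 1 / 2))
     in E a = E_max \<and> e\<^sub>2 > 0 \<and>
        (\<lambda>x. E x - (E_max - e\<^sub>2 * (x - a)\<^sup>2)) \<in> o[at a](\<lambda>x. (x - a)\<^sup>2))"
proof -
  interpret sp: spin_polygon N \<alpha>
    using assms(1,2) by unfold_locales auto
  have E: "E = sp.E" and \<tau>: "\<alpha>\<^sub>\<tau> = sp.\<alpha>\<^sub>\<tau>"
    by (auto simp: E_def sp.E_def \<alpha>\<^sub>\<tau>_def sp.\<alpha>\<^sub>\<tau>_def)
  obtain a where a: "0 < a" "a < \<alpha>\<^sub>\<tau>" "sp.total_angle a = pi / 2"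
    unfolding \<tau> by (rule sp.critical_coupling_exists)
  note a' = a[unfolded \<tau>]
  have "\<alpha>\<^sub>c < a"
    unfolding \<alpha>\<^sub>c_def by (rule sp.harmonic_coupling_less[OF a'])
  have E_a: "E a = - (\<Sum>\<mu>\<in>{0<..<N}. sqrt ((\<alpha> \<mu>)\<^sup>2 - a\<^sup>2))"
    using sp.E_parametrized[OF a'(1,2)] a(3) by (simp add: E cot_def)
  \<comment> \<open>The tangent at a has slope cos (pi / 2) = 0, which bounds E on the whole real
    line.\<close>
  have max: "E x \<le> E a" for x
    using sp.E_le_tangent[of a x] a' E_a by (simp add: E)
  have pos: "0 < sp.total_angle' a" using sp.total_angle'_pos[of a] a' by simp
  have expansion: "(\<lambda>x. E x - (E a + - sp.total_angle' a / 2 * (x - a)\<^sup>2)) \<in> o[at a](\<lambda>x. (x - a)\<^sup>2)"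
    unfolding E by (rule sp.E_second_order[OF a'])
  \<comment> \<open>The tolerance is half of the quadratic coefficient: the remainder cannot cancel
    the quadratic term, so the maximum at a is strict.\<close>
  have "\<forall>\<^sub>F x in at a. norm (E x - (E a + - sp.total_angle' a / 2 * (x - a)\<^sup>2))
      \<le> sp.total_angle' a / 4 * norm ((x - a)\<^sup>2)"
    using pos by (intro landau_o.smallD[OF expansion]) simp
  then have "\<forall>\<^sub>F x in at a. E x < E a"
    using eventually_neq_at_within[of a]
  proof eventually_elim
    case (elim x)
    then have "0 < sp.total_angle' a * (x - a)\<^sup>2" using pos by simp
    moreover have "E x - (E a + - sp.total_angle' a / 2 * (x - a)\<^sup>2) \<le> sp.total_angle' a / 4 * (x - a)\<^sup>2"
      using elim(1) by (simp only: real_norm_def abs_power2 abs_le_iff)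
    ultimately show ?case by (simp add: algebra_simps)
  qed
  then have unique: "y = a" if "E a \<le> E y" for y
    using concave_max_unique[OF sp.E_concave] that by (simp add: E)
  have locmax: "local_max_at E a" by (simp add: local_max_at_def max)
  have "{x \<in> {\<alpha>\<^sub>c<..<\<alpha>\<^sub>\<tau>}. local_extremum_at E x} = {a}"
  proof (intro subset_antisym subsetI)
    fix x assume "x \<in> {x \<in> {\<alpha>\<^sub>c<..<\<alpha>\<^sub>\<tau>}. local_extremum_at E x}"
    \<comment> \<open>By concavity a local extremum is a global maximum of E, and strictness at a
      leaves only a.\<close>
    then show "x \<in> {a}"
      using concave_local_extremum_imp_global_max[OF sp.E_concave] unique by (auto simp: E)
  qed (use \<open>\<alpha>\<^sub>c < a\<close> a locmax in \<open>auto simp: local_extremum_at_def\<close>)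
  moreover have "b \<in> {0..\<alpha>\<^sub>\<tau>} \<and> pi / 2 = (\<Sum>\<mu>\<in>{0<..<N}. arcsin (b / \<bar>\<alpha> \<mu>\<bar>)) \<longleftrightarrow> b = a" for b
    using sp.critical_coupling_unique[of a b] a unfolding \<tau> sp.total_angle_def by auto
  ultimately show ?thesis
    using a(2) locmax max E_a pos expansion sp.total_angle'_powr[of a] a'
    by (intro exI[of _ a]) (simp add: Let_def)
qed

end
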